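(* Let $M$ be a Riemannian manifold with Riemann curvature tensor $R$ and Levi-Civita connection $\nabla$, and let $dR$ be the Leibniz coboundary of the four-tensor $R$. Then for all $X,Y,Z,W,T\in\chi(M)$, $$\begin{aligned} dR(X\otimes Y\otimes Z\otimes W\otimes T)={}&-(\nabla_Z R)(X\otimes Y\otimes W\otimes T)\\ &+R(Z\otimes T\otimes Y\otimes\nabla_X W)-R(Y\otimes Z\otimes T\otimes\nabla_X W)\\ &-R(Z\otimes W\otimes Y\otimes\nabla_X T)+R(Y\otimes Z\otimes W\otimes\nabla_X T)\\ &-R(Z\otimes T\otimes X\otimes\nabla_Y W)+R(X\otimes Z\otimes T\otimes\nabla_Y W)\\ &+R(Z\otimes W\otimes X\otimes\nabla_Y T)-R(X\otimes Z\otimes W\otimes\nabla_Y T). \end{aligned}$$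
   Context: $\chi(M)$ is the Lie algebra of $C^\infty$ vector fields on $M$ and $\langle\ ,\ \rangle$ is the Riemannian metric. The curvature tensor is the four-tensor $$R(X\otimes Y\otimes Z\otimes W)=\langle\nabla_X\nabla_Y(Z)-\nabla_Y\nabla_X(Z)-\nabla_{[X,Y]}(Z),\,W\rangle.$$ For a $k$-tensor $\omega$ (a $C^\infty$ section of $T^*(M)^{\otimes k}$, acting on $\chi(M)^{\otimes k}$ pointwise), the covariant derivative is $$(\nabla_Z\omega)(X_1\otimes\cdots\otimes X_k)=Z\big(\omega(X_1\otimes\cdots\otimes X_k)\big)-\sum_{i=1}^k\omega\big(X_1\otimes\cdots\otimes\nabla_Z(X_i)\otimes\cdots\otimes X_k\big).$$ The Leibniz coboundary of an $\mathbf{R}$-linear map $\alpha:\chi(M)^{\otimes k}\to C^\infty(M)$ (tensor products over $\mathbf{R}$) is $$d\alpha(X_1\otimes\cdots\otimes X_{k+1})=\sum_{i=1}^{k+1}(-1)^{i+1}X_i\big(\alpha(X_1\otimes\cdots\hat X_i\cdots\otimes X_{k+1})\big)+\sum_{1\le i<j\le k+1}(-1)^{j+1}\alpha\big(X_1\otimes\cdots\otimes X_{i-1}\otimes[X_i,X_j]\otimes X_{i+1}\otimes\cdots\hat X_j\cdots\otimes X_{k+1}\big),$$ where a hat denotes omission. *)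

theory Defs
  imports "HOL-Analysis.Analysis" "HOL-Library.Function_Algebras"
begin

section \<open>Smooth manifolds\<close>

text \<open>
  The underlying topological space of the manifold is a whole type \<open>'a\<close> (Hausdorff and second
  countable by its type class). Charts take values in a normed space \<open>'e\<close>, which
  \<open>smooth_manifold\<close> below requires to be finite-dimensional; unlike \<open>euclidean_space\<close>, this
  includes dimension zero.
\<close>

type_synonym ('a, 'e) chart = "'a set \<times> ('a \<Rightarrow> 'e)"

text \<open>
  On open subsets of a finite-dimensional space, continuity of the Frechet derivative amounts to
  continuity of all directional derivatives, so this is the usual \<open>C\<^sup>k\<close> for open \<open>S\<close>.
\<close>

primrec Ck_on :: "nat \<Rightarrow> 'e::real_normed_vector set \<Rightarrow> ('e \<Rightarrow> 'f::real_normed_vector) \<Rightarrow> bool" where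
  "Ck_on 0 S f = continuous_on S f"
| "Ck_on (Suc k) S f =
    ((\<forall>x\<in>S. f differentiable at x) \<and> (\<forall>v. Ck_on k S (\<lambda>x. frechet_derivative f (at x) v)))"

definition smooth_on :: "'e::real_normed_vector set \<Rightarrow> ('e \<Rightarrow> 'f::real_normed_vector) \<Rightarrow> bool" where
  "smooth_on S f \<longleftrightarrow> (\<forall>k. Ck_on k S f)"

definition is_chart :: "('a::topological_space, 'e::real_normed_vector) chart \<Rightarrow> bool" where
  "is_chart c \<longleftrightarrow> (case c of (U, \<phi>) \<Rightarrow>
     open U \<and> open (\<phi> ` U) \<and> (\<exists>\<psi>. homeomorphism U (\<phi> ` U) \<phi> \<psi>))"

text \<open>
  The atlas is not required to be maximal: every atlas determines a smooth structure, and
  everything below depends only on that structure.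
\<close>

locale smooth_manifold =
  fixes A :: "('a::{t2_space, second_countable_topology}, 'e::real_normed_vector) chart set"
  assumes finite_dim: "\<exists>B::'e set. finite B \<and> span B = UNIV"
    and charts: "\<And>c. c \<in> A \<Longrightarrow> is_chart c"
    and cover: "(\<Union>(U, \<phi>)\<in>A. U) = UNIV"
    and compatible: "\<And>U \<phi> V \<psi>. (U, \<phi>) \<in> A \<Longrightarrow> (V, \<psi>) \<in> A \<Longrightarrow>
      smooth_on (\<phi> ` (U \<inter> V)) (\<psi> \<circ> inv_into U \<phi>)"

definition smooth_functions ::
  "('a::topological_space, 'e::real_normed_vector) chart set \<Rightarrow> ('a \<Rightarrow> real) set" where
  "smooth_functions A = {f. \<forall>(U, \<phi>)\<in>A. smooth_on (\<phi> ` U) (f \<circ> inv_into U \<phi>)}"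


section \<open>Tangent vectors and vector fields\<close>

text \<open>
  A tangent vector at \<open>p\<close> is a derivation at \<open>p\<close> of the algebra of smooth functions. The value
  \<open>0\<close> on non-smooth functions only serves to make equality of tangent vectors extensional.
\<close>

type_synonym 'a tangent = "('a \<Rightarrow> real) \<Rightarrow> real"
type_synonym 'a vfield = "'a \<Rightarrow> 'a tangent"

definition tangent_space ::
  "('a::topological_space, 'e::real_normed_vector) chart set \<Rightarrow> 'a \<Rightarrow> 'a tangent set" where
  "tangent_space A p = {v.
     (\<forall>f\<in>smooth_functions A. \<forall>h\<in>smooth_functions A. v (f + h) = v f + v h) \<and>
     (\<forall>c. \<forall>f\<in>smooth_functions A. v (\<lambda>q. c * f q) = c * v f) \<and>
     (\<forall>f\<in>smooth_functions A. \<forall>h\<in>smooth_functions A. v (f * h) = f p * v h + h p * v f) \<and>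
     (\<forall>f. f \<notin> smooth_functions A \<longrightarrow> v f = 0)}"

definition deriv_along :: "'a vfield \<Rightarrow> ('a \<Rightarrow> real) \<Rightarrow> ('a \<Rightarrow> real)" where
  "deriv_along X f = (\<lambda>p. X p f)"

definition vector_fields ::
  "('a::topological_space, 'e::real_normed_vector) chart set \<Rightarrow> 'a vfield set" where
  "vector_fields A = {X. (\<forall>p. X p \<in> tangent_space A p) \<and>
     (\<forall>f\<in>smooth_functions A. deriv_along X f \<in> smooth_functions A)}"

definition vf_scale :: "('a \<Rightarrow> real) \<Rightarrow> 'a vfield \<Rightarrow> 'a vfield" where
  "vf_scale f X = (\<lambda>p h. f p * X p h)"

text \<open>
  For smooth vector fields the formula yields \<open>0\<close> on a non-smooth \<open>f\<close>, as required of a tangent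
  vector, because \<open>deriv_along X f\<close> and \<open>deriv_along Y f\<close> are then the zero function.
\<close>

definition lie_bracket :: "'a vfield \<Rightarrow> 'a vfield \<Rightarrow> 'a vfield" where
  "lie_bracket X Y = (\<lambda>p f. X p (deriv_along Y f) - Y p (deriv_along X f))"


section \<open>Riemannian metrics and the Levi-Civita connection\<close>

type_synonym 'a metric = "'a \<Rightarrow> 'a tangent \<Rightarrow> 'a tangent \<Rightarrow> real"

definition inner_vf :: "'a metric \<Rightarrow> 'a vfield \<Rightarrow> 'a vfield \<Rightarrow> ('a \<Rightarrow> real)" where
  "inner_vf g X Y = (\<lambda>p. g p (X p) (Y p))"

locale riemannian_manifold = smooth_manifold A
  for A :: "('a::{t2_space, second_countable_topology}, 'e::real_normed_vector) chart set" +
  fixes g :: "'a metric"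
  assumes g_add: "\<And>p u v w. u \<in> tangent_space A p \<Longrightarrow> v \<in> tangent_space A p \<Longrightarrow>
      w \<in> tangent_space A p \<Longrightarrow> g p (u + v) w = g p u w + g p v w"
    and g_scale: "\<And>p c u v. u \<in> tangent_space A p \<Longrightarrow> v \<in> tangent_space A p \<Longrightarrow>
      g p (\<lambda>f. c * u f) v = c * g p u v"
    and g_sym: "\<And>p u v. u \<in> tangent_space A p \<Longrightarrow> v \<in> tangent_space A p \<Longrightarrow>
      g p u v = g p v u"
    and g_pos: "\<And>p u. u \<in> tangent_space A p \<Longrightarrow> u \<noteq> 0 \<Longrightarrow> g p u u > 0"
    and g_smooth: "\<And>X Y. X \<in> vector_fields A \<Longrightarrow> Y \<in> vector_fields A \<Longrightarrow>
      inner_vf g X Y \<in> smooth_functions A"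

definition affine_connection ::
  "('a::topological_space, 'e::real_normed_vector) chart set \<Rightarrow>
   ('a vfield \<Rightarrow> 'a vfield \<Rightarrow> 'a vfield) \<Rightarrow> bool" where
  "affine_connection A nabla \<longleftrightarrow>
    (\<forall>X\<in>vector_fields A. \<forall>Y\<in>vector_fields A. nabla X Y \<in> vector_fields A) \<and>
    (\<forall>X\<in>vector_fields A. \<forall>X'\<in>vector_fields A. \<forall>Y\<in>vector_fields A.
       nabla (X + X') Y = nabla X Y + nabla X' Y) \<and>
    (\<forall>f\<in>smooth_functions A. \<forall>X\<in>vector_fields A. \<forall>Y\<in>vector_fields A.
       nabla (vf_scale f X) Y = vf_scale f (nabla X Y)) \<and>
    (\<forall>X\<in>vector_fields A. \<forall>Y\<in>vector_fields A. \<forall>Y'\<in>vector_fields A.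
       nabla X (Y + Y') = nabla X Y + nabla X Y') \<and>
    (\<forall>f\<in>smooth_functions A. \<forall>X\<in>vector_fields A. \<forall>Y\<in>vector_fields A.
       nabla X (vf_scale f Y) = vf_scale (deriv_along X f) Y + vf_scale f (nabla X Y))"

definition levi_civita_connection ::
  "('a::topological_space, 'e::real_normed_vector) chart set \<Rightarrow> 'a metric \<Rightarrow>
   ('a vfield \<Rightarrow> 'a vfield \<Rightarrow> 'a vfield) \<Rightarrow> bool" where
  "levi_civita_connection A g nabla \<longleftrightarrow>
    affine_connection A nabla \<and>
    (\<forall>X\<in>vector_fields A. \<forall>Y\<in>vector_fields A. nabla X Y - nabla Y X = lie_bracket X Y) \<and>
    (\<forall>X\<in>vector_fields A. \<forall>Y\<in>vector_fields A. \<forall>Z\<in>vector_fields A.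
       deriv_along X (inner_vf g Y Z) = inner_vf g (nabla X Y) Z + inner_vf g Y (nabla X Z))"


section \<open>Tensors, covariant derivative and Leibniz coboundary\<close>

text \<open>
  A multilinear map on the \<open>k\<close>-th tensor power of the space of vector fields is given by its
  values on elementary tensors, i.e. as a function of lists of \<open>k\<close> vector fields.
\<close>

type_synonym 'a cochain = "'a vfield list \<Rightarrow> ('a \<Rightarrow> real)"

definition riemann_tensor ::
  "'a metric \<Rightarrow> ('a vfield \<Rightarrow> 'a vfield \<Rightarrow> 'a vfield) \<Rightarrow> 'a cochain" where
  "riemann_tensor g nabla Xs = (case Xs of
     [X, Y, Z, W] \<Rightarrow>
       inner_vf g (nabla X (nabla Y Z) - nabla Y (nabla X Z) - nabla (lie_bracket X Y) Z) W
   | _ \<Rightarrow> 0)"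

definition cov_deriv ::
  "('a vfield \<Rightarrow> 'a vfield \<Rightarrow> 'a vfield) \<Rightarrow> 'a vfield \<Rightarrow> 'a cochain \<Rightarrow> 'a cochain" where
  "cov_deriv nabla Z \<omega> Xs =
     deriv_along Z (\<omega> Xs) - (\<Sum>i<length Xs. \<omega> (Xs[i := nabla Z (Xs ! i)]))"

definition omit :: "nat \<Rightarrow> 'b list \<Rightarrow> 'b list" where
  "omit i xs = take i xs @ drop (Suc i) xs"

text \<open>
  List positions start at \<open>0\<close>, so the usual signs \<open>(-1)\<^bsup>i+1\<^esup>\<close> and \<open>(-1)\<^bsup>j+1\<^esup>\<close>
  for arguments numbered from \<open>1\<close> become \<open>(-1)\<^bsup>i\<^esup>\<close> and \<open>(-1)\<^bsup>j\<^esup>\<close>.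
\<close>

definition leibniz_d :: "'a cochain \<Rightarrow> 'a cochain" where
  "leibniz_d \<alpha> Xs = (\<lambda>p.
     (\<Sum>i<length Xs. (-1) ^ i * deriv_along (Xs ! i) (\<alpha> (omit i Xs)) p) +
     (\<Sum>j<length Xs. \<Sum>i<j.
        (-1) ^ j * \<alpha> (omit j (Xs[i := lie_bracket (Xs ! i) (Xs ! j)])) p))"

end

theory Submission
  imports Defs
begin

text \<open>
  Expand every term \<open>X\<^sub>i (R (\<dots>))\<close> of the coboundary by the definition of the covariant derivative
  and every bracket as \<open>nabla U V - nabla V U\<close>, the connection being torsion-free. What comes out
  splits into two groups.

  The terms that differentiate \<open>R\<close> are
  \<open>(nabla\<^sub>X R)(Y,Z,W,T) - (nabla\<^sub>Y R)(X,Z,W,T) + (nabla\<^sub>Z R)(X,Y,W,T)\<close>, which vanish by the second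
  Bianchi identity in \<open>X, Y, Z\<close>, and \<open>- (nabla\<^sub>W R)(X,Y,Z,T) + (nabla\<^sub>T R)(X,Y,Z,W)\<close>. The pair
  symmetry of \<open>R\<close> moves \<open>Z, T, W\<close> to the first two slots of the latter, and the second Bianchi
  identity in \<open>W, Z, T\<close> turns their sum into \<open>- (nabla\<^sub>Z R)(X,Y,W,T)\<close>.

  The terms in which \<open>R\<close> is evaluated on a covariant derivative of an argument cancel, up to the
  antisymmetries of \<open>R\<close>, against the expanded brackets. The exceptions are those containing
  \<open>nabla\<^sub>X W\<close>, \<open>nabla\<^sub>X T\<close>, \<open>nabla\<^sub>Y W\<close> and \<open>nabla\<^sub>Y T\<close>: each of these four fields occurs
  in two terms, once from differentiating \<open>R\<close> and once from a bracket, and these eight terms are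
  the remaining ones of the theorem.

  So the theorem rests on the symmetries of \<open>R\<close> (\<open>Rm_skew12\<close>, \<open>Rm_skew34\<close>, \<open>Rm_pair_symmetry\<close>)
  and the second Bianchi identity (\<open>second_bianchi\<close>). All of them follow by formal computation
  from additivity of the operations involved, the Jacobi identity, metric compatibility and
  vanishing torsion. The analytic input is that differences of smooth functions are smooth: this
  makes vector fields an additive group on which derivatives, metric and connection are additive.
\<close>

section \<open>Differences of smooth functions and of vector fields\<close>

text \<open>
  Openness matters because differentiability at a point of \<open>S\<close> refers to a full neighbourhood.
\<close>

lemma Ck_on_cong:
  assumes "open S" "\<And>x. x \<in> S \<Longrightarrow> f x = h x" "Ck_on k S f"
  shows "Ck_on k S h"
  using assms(2,3)
proof (induction k arbitrary: f h)
  case 0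
  then show ?case
    using continuous_on_cong by auto
next
  case (Suc k)
  have D: "(h has_derivative frechet_derivative f (at x)) (at x)" if "x \<in> S" for x
  proof (rule has_derivative_transform_within_open[OF _ assms(1) that])
    show "(f has_derivative frechet_derivative f (at x)) (at x)"
      using Suc.prems(2) that by (simp add: frechet_derivative_works[symmetric])
  qed (use Suc.prems in auto)
  have "Ck_on k S (\<lambda>x. frechet_derivative h (at x) v)" for v
  proof (rule Suc.IH)
    show "Ck_on k S (\<lambda>x. frechet_derivative f (at x) v)"
      using Suc.prems(2) by simp
    show "frechet_derivative f (at x) v = frechet_derivative h (at x) v" if "x \<in> S" for x
      using frechet_derivative_at[OF D[OF that]] by simp
  qed
  moreover have "h differentiable at x" if "x \<in> S" for x
    using D[OF that] unfolding differentiable_def by blast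
  ultimately show ?case by simp
qed

lemma Ck_on_diff:
  assumes "open S" "Ck_on k S f" "Ck_on k S h"
  shows "Ck_on k S (\<lambda>x. f x - h x)"
  using assms(2,3)
proof (induction k arbitrary: f h)
  case 0
  then show ?case by (simp add: continuous_on_diff)
next
  case (Suc k)
  have D: "((\<lambda>x. f x - h x) has_derivative
      (\<lambda>v. frechet_derivative f (at x) v - frechet_derivative h (at x) v)) (at x)"
    if "x \<in> S" for x
    using Suc.prems that by (intro has_derivative_diff) (simp_all add: frechet_derivative_works[symmetric])
  have "Ck_on k S (\<lambda>x. frechet_derivative (\<lambda>x. f x - h x) (at x) v)" for v
  proof (rule Ck_on_cong[OF assms(1)])
    show "Ck_on k S (\<lambda>x. frechet_derivative f (at x) v - frechet_derivative h (at x) v)"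
      using Suc.prems by (intro Suc.IH) simp_all
    show "frechet_derivative f (at x) v - frechet_derivative h (at x) v =
        frechet_derivative (\<lambda>x. f x - h x) (at x) v" if "x \<in> S" for x
      using frechet_derivative_at[OF D[OF that]] by metis
  qed
  moreover have "(\<lambda>x. f x - h x) differentiable at x" if "x \<in> S" for x
    using D[OF that] unfolding differentiable_def by blast
  ultimately show ?case by simp
qed

lemma Ck_on_zero: "Ck_on k S (\<lambda>x. 0)"
  by (induction k) auto

lemma sum3_eq_0_iff: "a + b + c = 0 \<longleftrightarrow> a = - b - c" for a b c :: "'b::ab_group_add"
proof -
  have "a + (b + c) = 0 \<longleftrightarrow> a = - (b + c)"
    by (rule eq_neg_iff_add_eq_0[symmetric])
  then show ?thesis by (simp add: algebra_simps)
qed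

lemma tangent_space_diff:
  assumes "u \<in> tangent_space A p" "v \<in> tangent_space A p"
  shows "u - v \<in> tangent_space A p"
  using assms unfolding tangent_space_def by (auto simp: algebra_simps)

context smooth_manifold
begin

lemma open_chart_image: "(U, \<phi>) \<in> A \<Longrightarrow> open (\<phi> ` U)"
  using charts by (fastforce simp: is_chart_def)

lemma smooth_functions_diff:
  assumes "f \<in> smooth_functions A" "h \<in> smooth_functions A"
  shows "f - h \<in> smooth_functions A"
proof -
  have "smooth_on (\<phi> ` U) ((f - h) \<circ> inv_into U \<phi>)" if "(U, \<phi>) \<in> A" for U \<phi>
    using assms that Ck_on_diff[OF open_chart_image[OF that]]
    unfolding smooth_functions_def smooth_on_def by (fastforce simp: o_def)
  then show ?thesis by (auto simp: smooth_functions_def)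
qed

lemma zero_smooth: "0 \<in> smooth_functions A"
  using Ck_on_zero by (auto simp: smooth_functions_def smooth_on_def o_def)

lemma tangent_add:
  assumes "v \<in> tangent_space A p" "f \<in> smooth_functions A" "h \<in> smooth_functions A"
  shows "v (f + h) = v f + v h"
  using assms by (simp add: tangent_space_def)

lemma tangent_diff:
  assumes "v \<in> tangent_space A p" "f \<in> smooth_functions A" "h \<in> smooth_functions A"
  shows "v (f - h) = v f - v h"
  using tangent_add[OF assms(1) smooth_functions_diff[OF assms(2,3)] assms(3)] by simp

lemma vector_fields_tangent: "X \<in> vector_fields A \<Longrightarrow> X p \<in> tangent_space A p"
  by (simp add: vector_fields_def)

lemma vector_fields_diff:
  assumes "X \<in> vector_fields A" "Y \<in> vector_fields A"
  shows "X - Y \<in> vector_fields A"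
proof -
  have "deriv_along (X - Y) f = deriv_along X f - deriv_along Y f" for f
    by (simp add: deriv_along_def fun_eq_iff)
  then show ?thesis
    using assms smooth_functions_diff unfolding vector_fields_def
    by (auto intro: tangent_space_diff)
qed

lemma vector_fields_add:
  assumes "X \<in> vector_fields A" "Y \<in> vector_fields A"
  shows "X + Y \<in> vector_fields A"
proof -
  have "X - (Y - Y - Y) \<in> vector_fields A"
    using assms by (intro vector_fields_diff)
  then show ?thesis by simp
qed

lemma deriv_along_add:
  assumes "X \<in> vector_fields A" "f \<in> smooth_functions A" "h \<in> smooth_functions A"
  shows "deriv_along X (f + h) = deriv_along X f + deriv_along X h"
  using tangent_add[OF vector_fields_tangent[OF assms(1)] assms(2,3)]
  by (simp add: deriv_along_def fun_eq_iff)

lemma deriv_along_diff: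
  assumes "X \<in> vector_fields A" "f \<in> smooth_functions A" "h \<in> smooth_functions A"
  shows "deriv_along X (f - h) = deriv_along X f - deriv_along X h"
  using tangent_diff[OF vector_fields_tangent[OF assms(1)] assms(2,3)]
  by (simp add: deriv_along_def fun_eq_iff)

lemma deriv_along_minus:
  assumes "S \<in> vector_fields A" "f \<in> smooth_functions A"
  shows "deriv_along S (- f) = - deriv_along S f"
proof -
  have "deriv_along S (f - f - f) = deriv_along S f - deriv_along S f - deriv_along S f"
    using assms by (simp only: deriv_along_diff smooth_functions_diff)
  then show ?thesis by simp
qed

text \<open>
  A vector field sends a non-smooth function to the zero function, which is smooth. Hence the
  Jacobi identity, whose meaning as an equality of vector fields is to hold on every function, can
  be computed for smooth and non-smooth functions alike.
\<close>

lemma deriv_along_smooth: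
  assumes "X \<in> vector_fields A"
  shows "deriv_along X f \<in> smooth_functions A"
proof (cases "f \<in> smooth_functions A")
  case True
  then show ?thesis using assms by (simp add: vector_fields_def)
next
  case False
  then have "deriv_along X f = 0"
    using assms by (auto simp: deriv_along_def vector_fields_def tangent_space_def fun_eq_iff)
  then show ?thesis using zero_smooth by simp
qed

lemma deriv_along_lie_bracket:
  "deriv_along (lie_bracket X Y) f =
    deriv_along X (deriv_along Y f) - deriv_along Y (deriv_along X f)"
  by (simp add: deriv_along_def lie_bracket_def fun_eq_iff)

lemma vfield_eqI: "(\<And>f. deriv_along X f = deriv_along Y f) \<Longrightarrow> X = Y"
  unfolding deriv_along_def fun_eq_iff by blast

lemma jacobi:
  assumes "X \<in> vector_fields A" "Y \<in> vector_fields A" "Z \<in> vector_fields A"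
  shows "lie_bracket (lie_bracket X Y) Z + lie_bracket (lie_bracket Y Z) X +
    lie_bracket (lie_bracket Z X) Y = 0"
proof (rule vfield_eqI)
  fix f
  have "deriv_along (U + V) f = deriv_along U f + deriv_along V f" for U V :: "'a vfield"
    by (simp add: deriv_along_def fun_eq_iff)
  moreover have "deriv_along (0 :: 'a vfield) f = 0"
    by (simp add: deriv_along_def fun_eq_iff)
  ultimately show "deriv_along (lie_bracket (lie_bracket X Y) Z + lie_bracket (lie_bracket Y Z) X +
      lie_bracket (lie_bracket Z X) Y) f = deriv_along 0 f"
    using assms by (simp add: deriv_along_lie_bracket deriv_along_diff deriv_along_smooth)
qed

end

section \<open>Additivity of the metric and of the connection\<close>

context riemannian_manifold
begin

lemma inner_vf_commute:
  assumes "X \<in> vector_fields A" "Y \<in> vector_fields A"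
  shows "inner_vf g X Y = inner_vf g Y X"
  using assms g_sym[OF vector_fields_tangent vector_fields_tangent]
  by (simp add: inner_vf_def fun_eq_iff)

lemma inner_vf_diff_left:
  assumes "X \<in> vector_fields A" "Y \<in> vector_fields A" "Z \<in> vector_fields A"
  shows "inner_vf g (X - Y) Z = inner_vf g X Z - inner_vf g Y Z"
proof
  fix p
  have "g p (X p - Y p + Y p) (Z p) = g p (X p - Y p) (Z p) + g p (Y p) (Z p)"
    using assms by (intro g_add tangent_space_diff vector_fields_tangent)
  then show "inner_vf g (X - Y) Z p = (inner_vf g X Z - inner_vf g Y Z) p"
    by (simp add: inner_vf_def)
qed

lemma inner_vf_zero_left:
  assumes "W \<in> vector_fields A"
  shows "inner_vf g 0 W = 0"
  using inner_vf_diff_left[OF assms assms assms] by simp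

lemma inner_vf_minus_left:
  assumes "X \<in> vector_fields A" "W \<in> vector_fields A"
  shows "inner_vf g (- X) W = - inner_vf g X W"
proof -
  have "inner_vf g (X - X - X) W = inner_vf g X W - inner_vf g X W - inner_vf g X W"
    using assms by (simp only: inner_vf_diff_left vector_fields_diff)
  then show ?thesis by simp
qed

lemma inner_vf_add_left:
  assumes "X \<in> vector_fields A" "Y \<in> vector_fields A" "W \<in> vector_fields A"
  shows "inner_vf g (X + Y) W = inner_vf g X W + inner_vf g Y W"
  using assms g_add[OF vector_fields_tangent vector_fields_tangent vector_fields_tangent]
  by (simp add: inner_vf_def fun_eq_iff)

lemma inner_vf_diff_right:
  assumes "X \<in> vector_fields A" "Y \<in> vector_fields A" "Z \<in> vector_fields A"
  shows "inner_vf g Z (X - Y) = inner_vf g Z X - inner_vf g Z Y"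
  using assms by (simp add: inner_vf_commute[of Z] vector_fields_diff inner_vf_diff_left)

end

locale riemannian_manifold_with_levi_civita = riemannian_manifold A g
  for A :: "('a::{t2_space, second_countable_topology}, 'e::real_normed_vector) chart set"
    and g :: "'a metric" +
  fixes nabla :: "'a vfield \<Rightarrow> 'a vfield \<Rightarrow> 'a vfield"
  assumes levi_civita: "levi_civita_connection A g nabla"
begin

abbreviation VF :: "'a vfield set" where "VF \<equiv> vector_fields A"

lemma nabla_VF: "X \<in> VF \<Longrightarrow> Y \<in> VF \<Longrightarrow> nabla X Y \<in> VF"
  using levi_civita by (simp add: levi_civita_connection_def affine_connection_def)

lemma nabla_diff_left:
  assumes "X \<in> VF" "X' \<in> VF" "Y \<in> VF"
  shows "nabla (X - X') Y = nabla X Y - nabla X' Y"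
proof -
  have "nabla (X - X' + X') Y = nabla (X - X') Y + nabla X' Y"
    using levi_civita assms vector_fields_diff
    unfolding levi_civita_connection_def affine_connection_def by blast
  then show ?thesis by simp
qed

lemma nabla_diff_right:
  assumes "X \<in> VF" "Y \<in> VF" "Y' \<in> VF"
  shows "nabla X (Y - Y') = nabla X Y - nabla X Y'"
proof -
  have "nabla X (Y - Y' + Y') = nabla X (Y - Y') + nabla X Y'"
    using levi_civita assms vector_fields_diff
    unfolding levi_civita_connection_def affine_connection_def by blast
  then show ?thesis by simp
qed

lemma torsion_free: "X \<in> VF \<Longrightarrow> Y \<in> VF \<Longrightarrow> lie_bracket X Y = nabla X Y - nabla Y X"
  using levi_civita by (simp add: levi_civita_connection_def)

lemma metric_compatible:
  assumes "X \<in> VF" "Y \<in> VF" "Z \<in> VF"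
  shows "deriv_along X (inner_vf g Y Z) = inner_vf g (nabla X Y) Z + inner_vf g Y (nabla X Z)"
  using levi_civita assms by (simp add: levi_civita_connection_def)

lemma lie_bracket_VF: "X \<in> VF \<Longrightarrow> Y \<in> VF \<Longrightarrow> lie_bracket X Y \<in> VF"
  by (simp add: torsion_free nabla_VF vector_fields_diff)

lemma lie_bracket_minus: "lie_bracket Y X = - lie_bracket X Y"
  by (simp add: lie_bracket_def fun_eq_iff)

lemma nabla_minus_left:
  assumes "X \<in> VF" "Y \<in> VF"
  shows "nabla (- X) Y = - nabla X Y"
proof -
  have 0: "X - X \<in> VF" using assms vector_fields_diff by blast
  have "nabla (X - X - X) Y = nabla X Y - nabla X Y - nabla X Y"
    using assms 0 by (simp only: nabla_diff_left)
  then show ?thesis by simp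
qed

section \<open>Symmetries of the curvature tensor\<close>

definition curv :: "'a vfield \<Rightarrow> 'a vfield \<Rightarrow> 'a vfield \<Rightarrow> 'a vfield" where
  "curv X Y Z = nabla X (nabla Y Z) - nabla Y (nabla X Z) - nabla (lie_bracket X Y) Z"

definition Rm :: "'a vfield \<Rightarrow> 'a vfield \<Rightarrow> 'a vfield \<Rightarrow> 'a vfield \<Rightarrow> 'a \<Rightarrow> real" where
  "Rm X Y Z W = inner_vf g (curv X Y Z) W"

lemma riemann_tensor_eq_Rm: "riemann_tensor g nabla [X, Y, Z, W] = Rm X Y Z W"
  by (simp add: riemann_tensor_def Rm_def curv_def)

lemmas VF_closed = nabla_VF vector_fields_diff lie_bracket_VF

lemma curv_VF: "X \<in> VF \<Longrightarrow> Y \<in> VF \<Longrightarrow> Z \<in> VF \<Longrightarrow> curv X Y Z \<in> VF"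
  by (simp add: curv_def VF_closed)

lemma curv_skew:
  assumes "X \<in> VF" "Y \<in> VF" "Z \<in> VF"
  shows "curv Y X Z = - curv X Y Z"
  using assms by (simp add: curv_def lie_bracket_minus[of Y X] nabla_minus_left lie_bracket_VF)

lemma curv_diff_left:
  assumes "X \<in> VF" "X' \<in> VF" "Y \<in> VF" "Z \<in> VF"
  shows "curv (X - X') Y Z = curv X Y Z - curv X' Y Z"
  using assms by (simp add: curv_def torsion_free VF_closed nabla_diff_left nabla_diff_right)

lemma curv_diff_middle:
  assumes "X \<in> VF" "Y \<in> VF" "Y' \<in> VF" "Z \<in> VF"
  shows "curv X (Y - Y') Z = curv X Y Z - curv X Y' Z"
  using assms by (simp add: curv_def torsion_free VF_closed nabla_diff_left nabla_diff_right)

lemma curv_diff_right: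
  assumes "X \<in> VF" "Y \<in> VF" "Z \<in> VF" "Z' \<in> VF"
  shows "curv X Y (Z - Z') = curv X Y Z - curv X Y Z'"
  using assms by (simp add: curv_def VF_closed nabla_diff_right)

lemmas Rm_diff_simps = Rm_def curv_VF vector_fields_diff inner_vf_diff_left inner_vf_diff_right
  curv_diff_left curv_diff_middle curv_diff_right

lemma Rm_diff1:
  assumes "X \<in> VF" "X' \<in> VF" "Y \<in> VF" "Z \<in> VF" "W \<in> VF"
  shows "Rm (X - X') Y Z W = Rm X Y Z W - Rm X' Y Z W"
  using assms by (simp add: Rm_diff_simps)

lemma Rm_diff2:
  assumes "X \<in> VF" "Y \<in> VF" "Y' \<in> VF" "Z \<in> VF" "W \<in> VF"
  shows "Rm X (Y - Y') Z W = Rm X Y Z W - Rm X Y' Z W"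
  using assms by (simp add: Rm_diff_simps)

lemma Rm_diff3:
  assumes "X \<in> VF" "Y \<in> VF" "Z \<in> VF" "Z' \<in> VF" "W \<in> VF"
  shows "Rm X Y (Z - Z') W = Rm X Y Z W - Rm X Y Z' W"
  using assms by (simp add: Rm_diff_simps)

lemma Rm_diff4:
  assumes "X \<in> VF" "Y \<in> VF" "Z \<in> VF" "W \<in> VF" "W' \<in> VF"
  shows "Rm X Y Z (W - W') = Rm X Y Z W - Rm X Y Z W'"
  using assms by (simp add: Rm_diff_simps)

lemma Rm_skew12:
  assumes "X \<in> VF" "Y \<in> VF" "Z \<in> VF" "W \<in> VF"
  shows "Rm Y X Z W = - Rm X Y Z W"
  using assms by (simp add: Rm_def curv_skew[of X Y] inner_vf_minus_left curv_VF)

text \<open>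
  The metric is parallel, so the commutator of second derivatives of the function
  \<open>inner_vf g Z W\<close>, corrected by its derivative along the bracket, is \<open>Rm X Y Z W + Rm X Y W Z\<close>.
  On a function this corrected commutator is zero.
\<close>

lemma Rm_skew34:
  assumes "X \<in> VF" "Y \<in> VF" "Z \<in> VF" "W \<in> VF"
  shows "Rm X Y W Z = - Rm X Y Z W"
proof -
  let ?f = "inner_vf g Z W"
  have second: "deriv_along U (deriv_along V ?f) =
      inner_vf g (nabla U (nabla V Z)) W + inner_vf g (nabla V Z) (nabla U W) +
      (inner_vf g (nabla U Z) (nabla V W) + inner_vf g (nabla U (nabla V W)) Z)"
    if "U \<in> VF" "V \<in> VF" for U V
    using that assms
    by (simp add: metric_compatible nabla_VF deriv_along_add g_smooth
        inner_vf_commute[of Z "nabla U (nabla V W)"])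
  have "deriv_along (lie_bracket X Y) ?f =
      inner_vf g (nabla (lie_bracket X Y) Z) W + inner_vf g (nabla (lie_bracket X Y) W) Z"
    using assms
    by (simp add: metric_compatible VF_closed inner_vf_commute[of Z "nabla (lie_bracket X Y) W"])
  moreover have "deriv_along (lie_bracket X Y) ?f =
      deriv_along X (deriv_along Y ?f) - deriv_along Y (deriv_along X ?f)"
    by (rule deriv_along_lie_bracket)
  ultimately have "Rm X Y Z W + Rm X Y W Z = 0"
    using assms
    by (simp add: second Rm_def curv_def inner_vf_diff_left VF_closed) (simp add: algebra_simps)
  then show ?thesis by (simp add: eq_neg_iff_add_eq_0 add.commute)
qed

text \<open>
  Vanishing torsion collects the six second derivatives into
  \<open>nabla X (lie_bracket Y Z) - nabla (lie_bracket Y Z) X\<close> and its cyclic permutations, that is,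
  into double brackets, and the Jacobi identity applies.
\<close>

lemma first_bianchi_curv:
  assumes "X \<in> VF" "Y \<in> VF" "Z \<in> VF"
  shows "curv X Y Z + curv Y Z X + curv Z X Y = 0"
proof -
  have double: "lie_bracket (lie_bracket U V) S =
      nabla (lie_bracket U V) S - (nabla S (nabla U V) - nabla S (nabla V U))"
    if "U \<in> VF" "V \<in> VF" "S \<in> VF" for U V S
    using that torsion_free[of "lie_bracket U V" S]
    by (simp add: torsion_free[of U V] lie_bracket_VF nabla_VF vector_fields_diff nabla_diff_right)
  have "curv X Y Z + curv Y Z X + curv Z X Y =
      - (lie_bracket (lie_bracket X Y) Z + lie_bracket (lie_bracket Y Z) X +
         lie_bracket (lie_bracket Z X) Y)"
    using assms by (simp add: double curv_def algebra_simps)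
  then show ?thesis using jacobi[OF assms] by simp
qed

lemma first_bianchi:
  assumes "X \<in> VF" "Y \<in> VF" "Z \<in> VF" "W \<in> VF"
  shows "Rm X Y Z W + Rm Y Z X W + Rm Z X Y W = 0"
proof -
  have eq: "curv X Y Z = - curv Y Z X - curv Z X Y"
    using first_bianchi_curv[OF assms(1-3)] by (simp only: sum3_eq_0_iff)
  have "- curv Y Z X = curv Z Y X"
    using curv_skew[of Y Z X] assms by simp
  then have "Rm X Y Z W = Rm Z Y X W - Rm Z X Y W"
    using eq assms by (simp add: Rm_def inner_vf_diff_left curv_VF)
  then show ?thesis using Rm_skew12[of Y Z X W] assms by simp
qed

text \<open>
  Add the first Bianchi identities with \<open>W\<close> and with \<open>X\<close> in the last slot and subtract those with
  \<open>Y\<close> and with \<open>Z\<close> there. By the two antisymmetries everything cancels except twice the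
  difference of the two sides.
\<close>

lemma Rm_pair_symmetry:
  assumes "X \<in> VF" "Y \<in> VF" "Z \<in> VF" "W \<in> VF"
  shows "Rm X Y Z W = Rm Z W X Y"
proof
  fix p
  have skew12: "Rm b a c d p = - Rm a b c d p"
    and skew34: "Rm a b d c p = - Rm a b c d p"
    and cyclic: "Rm a b c d p + Rm b c a d p + Rm c a b d p = 0"
    if "a \<in> VF" "b \<in> VF" "c \<in> VF" "d \<in> VF" for a b c d
    using Rm_skew12[OF that] Rm_skew34[OF that] first_bianchi[OF that]
    by (simp_all add: fun_eq_iff)
  show "Rm X Y Z W p = Rm Z W X Y p"
    using cyclic[OF assms(1,2,3,4)] cyclic[OF assms(2,3,4,1)]
      cyclic[OF assms(3,4,1,2)] cyclic[OF assms(4,1,2,3)]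
      skew34[OF assms(1,2,3,4)] skew34[OF assms(3,4,1,2)]
      skew34[OF assms(2,3,1,4)] skew34[OF assms(4,1,2,3)]
      skew12[OF assms(1,3,2,4)] skew34[OF assms(1,3,2,4)]
      skew12[OF assms(4,2,1,3)] skew34[OF assms(4,2,1,3)]
    by linarith
qed

section \<open>The second Bianchi identity\<close>

definition cov_Rm ::
  "'a vfield \<Rightarrow> 'a vfield \<Rightarrow> 'a vfield \<Rightarrow> 'a vfield \<Rightarrow> 'a vfield \<Rightarrow> 'a \<Rightarrow> real" where
  "cov_Rm S X Y Z W = deriv_along S (Rm X Y Z W) -
     (Rm (nabla S X) Y Z W + Rm X (nabla S Y) Z W + Rm X Y (nabla S Z) W + Rm X Y Z (nabla S W))"

lemma cov_deriv_riemann_tensor: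
  "cov_deriv nabla S (riemann_tensor g nabla) [X, Y, Z, W] = cov_Rm S X Y Z W"
  by (simp add: cov_deriv_def cov_Rm_def riemann_tensor_eq_Rm numeral_2_eq_2 numeral_3_eq_3)

lemma deriv_along_Rm:
  assumes "S \<in> VF" "X \<in> VF" "Y \<in> VF" "Z \<in> VF" "W \<in> VF"
  shows "deriv_along S (Rm X Y Z W) = inner_vf g (nabla S (curv X Y Z)) W + Rm X Y Z (nabla S W)"
  using assms by (simp add: Rm_def metric_compatible curv_VF)

text \<open>
  With \<open>curv Y Z\<close> written as the commutator of \<open>nabla Y\<close> and \<open>nabla Z\<close> minus
  \<open>nabla (lie_bracket Y Z)\<close>, this is the Jacobi identity for commutators of operators on vector
  fields, together with the Jacobi identity for the bracket inside \<open>nabla\<close>.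
\<close>

lemma second_bianchi_curv:
  assumes "X \<in> VF" "Y \<in> VF" "Z \<in> VF" "W \<in> VF"
  shows "(nabla X (curv Y Z W) - curv Y Z (nabla X W) - curv (lie_bracket X Y) Z W) +
     (nabla Y (curv Z X W) - curv Z X (nabla Y W) - curv (lie_bracket Y Z) X W) +
     (nabla Z (curv X Y W) - curv X Y (nabla Z W) - curv (lie_bracket Z X) Y W) = 0"
proof -
  let ?a = "lie_bracket (lie_bracket X Y) Z"
  let ?b = "lie_bracket (lie_bracket Y Z) X"
  let ?c = "lie_bracket (lie_bracket Z X) Y"
  have VF: "?a \<in> VF" "?b \<in> VF" "?c \<in> VF" using assms by (simp_all add: lie_bracket_VF)
  have "?a = - ?b - ?c"
    using jacobi[OF assms(1-3)] by (simp only: sum3_eq_0_iff)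
  also have "- ?b = lie_bracket X (lie_bracket Y Z)"
    by (simp add: lie_bracket_minus[of X])
  finally have "nabla ?a W = nabla (lie_bracket X (lie_bracket Y Z)) W - nabla ?c W"
    using assms by (simp only: nabla_diff_left lie_bracket_VF)
  also have "nabla (lie_bracket X (lie_bracket Y Z)) W = - nabla ?b W"
    using VF assms by (simp add: lie_bracket_minus[of X] nabla_minus_left)
  finally have "nabla ?a W + nabla ?b W + nabla ?c W = 0"
    by (simp only: sum3_eq_0_iff)
  moreover have nabla_curv: "nabla U (curv V S W) = nabla U (nabla V (nabla S W)) -
      nabla U (nabla S (nabla V W)) - nabla U (nabla (lie_bracket V S) W)"
    if "U \<in> VF" "V \<in> VF" "S \<in> VF" for U V S
    using that assms by (simp add: curv_def nabla_diff_right VF_closed)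
  ultimately show ?thesis
    unfolding nabla_curv[OF assms(1-3)] nabla_curv[OF assms(2,3,1)] nabla_curv[OF assms(3,1,2)]
    by (simp add: curv_def algebra_simps)
qed

lemma second_bianchi:
  assumes "X \<in> VF" "Y \<in> VF" "Z \<in> VF" "W \<in> VF" "T \<in> VF"
  shows "cov_Rm X Y Z W T + cov_Rm Y Z X W T + cov_Rm Z X Y W T = 0"
proof -
  define E where "E a b c = nabla a (curv b c W) - curv b c (nabla a W) - curv (lie_bracket a b) c W"
    for a b c
  have E_VF: "E a b c \<in> VF" if "a \<in> VF" "b \<in> VF" "c \<in> VF" for a b c
    using that assms by (simp add: E_def curv_VF VF_closed)
  \<comment> \<open>The two curvature terms on the right cancel in the cyclic sum.\<close>
  have E: "inner_vf g (E a b c) T =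
      cov_Rm a b c W T + Rm (nabla b a) c W T - Rm (nabla a c) b W T"
    if "a \<in> VF" "b \<in> VF" "c \<in> VF" for a b c
  proof -
    have "inner_vf g (E a b c) T = inner_vf g (nabla a (curv b c W)) T
        - Rm b c (nabla a W) T - (Rm (nabla a b) c W T - Rm (nabla b a) c W T)"
      using that assms
      by (simp add: E_def Rm_def inner_vf_diff_left torsion_free[of a b] curv_diff_left
          curv_VF VF_closed)
    then show ?thesis
      using that assms Rm_skew12[of "nabla a c" b W T]
      by (simp add: cov_Rm_def deriv_along_Rm nabla_VF algebra_simps)
  qed
  have "E X Y Z + E Y Z X + E Z X Y = 0"
    using second_bianchi_curv[OF assms(1-4)] by (simp add: E_def)
  then have "inner_vf g (E X Y Z) T + inner_vf g (E Y Z X) T + inner_vf g (E Z X Y) T = 0"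
    using inner_vf_add_left[of "E X Y Z + E Y Z X" "E Z X Y" T]
      inner_vf_add_left[of "E X Y Z" "E Y Z X" T] assms
    by (simp add: E_VF vector_fields_add inner_vf_zero_left)
  then show ?thesis using assms by (simp add: E algebra_simps)
qed

lemma cov_Rm_pair_symmetry:
  assumes "S \<in> VF" "X \<in> VF" "Y \<in> VF" "Z \<in> VF" "W \<in> VF"
  shows "cov_Rm S X Y Z W = cov_Rm S Z W X Y"
  using assms
  by (simp add: cov_Rm_def nabla_VF Rm_pair_symmetry[of X Y Z W]
      Rm_pair_symmetry[of "nabla S X" Y Z W] Rm_pair_symmetry[of X "nabla S Y" Z W]
      Rm_pair_symmetry[of X Y "nabla S Z" W] Rm_pair_symmetry[of X Y Z "nabla S W"])

lemma Rm_smooth: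
  "X \<in> VF \<Longrightarrow> Y \<in> VF \<Longrightarrow> Z \<in> VF \<Longrightarrow> W \<in> VF \<Longrightarrow> Rm X Y Z W \<in> smooth_functions A"
  by (simp add: Rm_def g_smooth curv_VF)

lemma cov_Rm_skew12:
  assumes "S \<in> VF" "X \<in> VF" "Y \<in> VF" "Z \<in> VF" "W \<in> VF"
  shows "cov_Rm S Y X Z W = - cov_Rm S X Y Z W"
  using assms
  by (simp add: cov_Rm_def nabla_VF Rm_skew12[of X Y] Rm_skew12[of "nabla S X" Y]
      Rm_skew12[of X "nabla S Y"] deriv_along_minus Rm_smooth)

section \<open>The Leibniz coboundary of the curvature tensor\<close>

text \<open>
  The last two derivative terms of the coboundary differentiate along fields from the second pair
  of slots, which the second Bianchi identity reaches only through the pair symmetry.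
\<close>

lemma second_bianchi_last_pair:
  assumes "X \<in> VF" "Y \<in> VF" "Z \<in> VF" "W \<in> VF" "T \<in> VF"
  shows "cov_Rm T X Y Z W - cov_Rm W X Y Z T = - cov_Rm Z X Y W T"
proof -
  have "cov_Rm W Z T X Y + cov_Rm Z T W X Y + cov_Rm T W Z X Y = 0"
    using assms by (intro second_bianchi)
  then show ?thesis
    using assms cov_Rm_skew12[of Z W T X Y] cov_Rm_skew12[of T Z W X Y]
    by (simp add: cov_Rm_pair_symmetry[of _ X Y] algebra_simps)
qed

lemma leibniz_d_riemann_tensor:
  assumes "X \<in> VF" "Y \<in> VF" "Z \<in> VF" "W \<in> VF" "T \<in> VF"
  shows "leibniz_d (riemann_tensor g nabla) [X, Y, Z, W, T] =
    deriv_along X (Rm Y Z W T) - deriv_along Y (Rm X Z W T) + deriv_along Z (Rm X Y W T)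
    - deriv_along W (Rm X Y Z T) + deriv_along T (Rm X Y Z W)
    - Rm (lie_bracket X Y) Z W T
    + Rm (lie_bracket X Z) Y W T + Rm X (lie_bracket Y Z) W T
    - Rm (lie_bracket X W) Y Z T - Rm X (lie_bracket Y W) Z T - Rm X Y (lie_bracket Z W) T
    + Rm (lie_bracket X T) Y Z W + Rm X (lie_bracket Y T) Z W + Rm X Y (lie_bracket Z T) W
    + Rm X Y Z (lie_bracket W T)"
  by (simp add: leibniz_d_def omit_def fun_eq_iff riemann_tensor_eq_Rm numeral_2_eq_2 numeral_3_eq_3)

end

theorem lemma4p3:
  fixes A :: "('a::{t2_space, second_countable_topology}, 'e::real_normed_vector) chart set"
    and g :: "'a metric"
    and nabla :: "'a vfield \<Rightarrow> 'a vfield \<Rightarrow> 'a vfield"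
    and R :: "'a cochain"
    and X Y Z W T :: "'a vfield"
  defines "R \<equiv> riemann_tensor g nabla"
  assumes "riemannian_manifold A g"
    and "levi_civita_connection A g nabla"
    and "X \<in> vector_fields A" and "Y \<in> vector_fields A" and "Z \<in> vector_fields A"
    and "W \<in> vector_fields A" and "T \<in> vector_fields A"
  shows "leibniz_d R [X, Y, Z, W, T] =
    - cov_deriv nabla Z R [X, Y, W, T]
    + R [Z, T, Y, nabla X W] - R [Y, Z, T, nabla X W]
    - R [Z, W, Y, nabla X T] + R [Y, Z, W, nabla X T]
    - R [Z, T, X, nabla Y W] + R [X, Z, T, nabla Y W]
    + R [Z, W, X, nabla Y T] - R [X, Z, W, nabla Y T]"
proof -
  interpret riemannian_manifold_with_levi_civita A g nabla
    using assms(2,3)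
    by (simp add: riemannian_manifold_with_levi_civita_def
        riemannian_manifold_with_levi_civita_axioms_def)
  note VF = assms(4-8)
  note R = riemann_tensor_eq_Rm[folded R_def]
  have bianchi_XYZ: "cov_Rm X Y Z W T - cov_Rm Y X Z W T + cov_Rm Z X Y W T = 0"
    using second_bianchi[OF VF] cov_Rm_skew12[of Y X Z W T] VF by simp
  have derivatives: "deriv_along S (Rm a b c d) = cov_Rm S a b c d + Rm (nabla S a) b c d
      + Rm a (nabla S b) c d + Rm a b (nabla S c) d + Rm a b c (nabla S d)" for S a b c d
    by (simp add: cov_Rm_def)
  have "leibniz_d R [X, Y, Z, W, T] =
      (cov_Rm X Y Z W T - cov_Rm Y X Z W T + cov_Rm Z X Y W T)
      + (cov_Rm T X Y Z W - cov_Rm W X Y Z T)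
      - Rm (nabla X W) Y Z T + Rm Y Z (nabla X W) T
      + Rm (nabla X T) Y Z W + Rm Y Z W (nabla X T)
      - Rm X (nabla Y W) Z T - Rm X Z (nabla Y W) T
      + Rm X (nabla Y T) Z W - Rm X Z W (nabla Y T)"
    \<comment> \<open>Differentiation puts \<open>nabla X Z\<close> into the second slot and \<open>nabla Z T\<close> into the fourth,
      the brackets put them into the first and the third; antisymmetry makes the terms cancel.\<close>
    using VF Rm_skew12[of Y "nabla X Z" W T] Rm_skew34[of X Y "nabla Z T" W]
    unfolding R_def leibniz_d_riemann_tensor[OF VF] derivatives
    by (simp add: torsion_free nabla_VF Rm_diff1 Rm_diff2 Rm_diff3 Rm_diff4)
  also have "\<dots> = - cov_Rm Z X Y W T
      + Rm Z T Y (nabla X W) - Rm Y Z T (nabla X W)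
      - Rm Z W Y (nabla X T) + Rm Y Z W (nabla X T)
      - Rm Z T X (nabla Y W) + Rm X Z T (nabla Y W)
      + Rm Z W X (nabla Y T) - Rm X Z W (nabla Y T)"
  proof -
    have "Rm (nabla X W) Y Z T = - Rm Z T Y (nabla X W)"
      and "Rm (nabla X T) Y Z W = - Rm Z W Y (nabla X T)"
      using VF by (simp_all add: nabla_VF Rm_pair_symmetry[of "nabla X _" Y] Rm_skew34[of Z _ Y])
    moreover have "Rm X (nabla Y W) Z T = Rm Z T X (nabla Y W)"
      and "Rm X (nabla Y T) Z W = Rm Z W X (nabla Y T)"
      using VF by (simp_all add: nabla_VF Rm_pair_symmetry[of X "nabla Y _"])
    moreover have "Rm Y Z (nabla X W) T = - Rm Y Z T (nabla X W)"
      and "Rm X Z (nabla Y W) T = - Rm X Z T (nabla Y W)"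
      using VF by (simp_all add: nabla_VF Rm_skew34[of _ Z T])
    ultimately show ?thesis
      using VF by (simp add: bianchi_XYZ second_bianchi_last_pair)
  qed
  finally show ?thesis
    unfolding R cov_deriv_riemann_tensor[folded R_def] .
qed

end
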